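(* Let $\Phi\in\mathbb{R}^{N\times N}$ be a non-zero symmetric matrix with non-negative entries. Let $G$ be a multigraph with $|V(G)|=m$ and $|E(G)|=d$ where every vertex has degree at least $2$. Then $$\tilde f_G(\Phi)\le\left(\frac{N(1+\|\Phi\|_{\ell^\infty})^2}{\|\Phi\|}\right)^{2d-2m+|\mathrm{conn}(G)|}\|\Phi\|^m.$$
   Context: Multigraphs may have self-loops and parallel edges; edges are counted with multiplicity, and a self-loop contributes $2$ to the degree of its vertex. $\mathrm{conn}(G)$ is the set of connected components of $G$. $\|\Phi\|$ is the spectral norm and $\|\Phi\|_{\ell^\infty}=\max_{i,j}|\Phi_{ij}|$. For a multigraph $G$, $$\tilde f_G(\Phi):=\sum_{i:V(G)\to[N]}\ \prod_{\{x,y\}\in E(G)}\Phi_{i(x)i(y)},$$ the sum being over all (not necessarily injective) functions and the product over edges with multiplicity (a self-loop at $x$ contributes $\Phi_{i(x)i(x)}$). *)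

theory Defs
  imports "HOL-Analysis.Analysis" "HOL-Library.Multiset" "HOL-Library.Uprod"
begin

text \<open>
  Edges form a multiset of unordered pairs: \<^term>\<open>Upair x x\<close> is a self-loop, and the multiplicity
  of a pair is its number of parallel edges.
\<close>

record 'v multigraph =
  verts :: "'v set"
  edges :: "'v uprod multiset"

definition is_multigraph :: "'v multigraph \<Rightarrow> bool" where
  "is_multigraph G \<longleftrightarrow> finite (verts G) \<and> (\<forall>e \<in># edges G. set_uprod e \<subseteq> verts G)"

definition degree :: "'v multigraph \<Rightarrow> 'v \<Rightarrow> nat" where
  "degree G v =
    (\<Sum>e \<in># edges G. if e = Upair v v then 2 else if v \<in> set_uprod e then 1 else 0)"

definition connected_rel :: "'v multigraph \<Rightarrow> ('v \<times> 'v) set" where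
  "connected_rel G = {(x, y). x \<in> verts G \<and> y \<in> verts G \<and>
     (x, y) \<in> {(a, b). Upair a b \<in># edges G}\<^sup>*}"

text \<open>A component is represented by its vertex set.\<close>

definition conn :: "'v multigraph \<Rightarrow> 'v set set" where
  "conn G = verts G // connected_rel G"

definition spectral_norm :: "real ^ 'n ^ 'n \<Rightarrow> real" where
  "spectral_norm \<Phi> = onorm (\<lambda>x. \<Phi> *v x)"

definition linf_norm :: "real ^ 'n ^ 'n \<Rightarrow> real" where
  "linf_norm \<Phi> = Max {\<bar>\<Phi> $ i $ j\<bar> | i j. True}"

text \<open>
  The entry of \<open>\<Phi>\<close> at an unordered pair of indices. It is meaningful for symmetric \<open>\<Phi>\<close> only, as
  otherwise \<open>\<Phi> $ a $ b\<close> depends on the order of \<open>a\<close> and \<open>b\<close>; see \<open>entry_Upair\<close>.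
\<close>

definition entry :: "real ^ 'n ^ 'n \<Rightarrow> 'n uprod \<Rightarrow> real" where
  "entry \<Phi> u = (THE w. \<exists>a b. u = Upair a b \<and> w = \<Phi> $ a $ b)"

lemma entry_Upair:
  assumes "transpose \<Phi> = \<Phi>"
  shows "entry \<Phi> (Upair a b) = \<Phi> $ a $ b"
proof -
  have sym: "\<Phi> $ x $ y = \<Phi> $ y $ x" for x y
    by (metis assms transpose_def vec_lambda_beta)
  show ?thesis
    unfolding entry_def by (rule the_equality) (auto simp: sym)
qed

text \<open>
  The index set \<open>[N]\<close> is the type \<open>'n\<close>, so \<open>N\<close> is \<open>CARD('n)\<close>. Labellings are taken from the
  extensional function space so that each function on \<open>verts G\<close> is counted exactly once.
\<close>

definition f_tilde :: "'v multigraph \<Rightarrow> real ^ 'n ^ 'n \<Rightarrow> real" where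
  "f_tilde G \<Phi> =
    (\<Sum>i \<in> verts G \<rightarrow>\<^sub>E (UNIV :: 'n set). \<Prod>e \<in># edges G. entry \<Phi> (map_uprod i e))"

end

theory Submission
  imports Defs
begin

text \<open>
  A cover of the vertices by \<open>c\<close> disjoint paths of \<open>G\<close> uses \<open>m - c\<close> edges. Bounding each of the
  other \<open>d - m + c\<close> edges by \<open>\<parallel>\<Phi>\<parallel>\<^sub>\<infinity>\<close> makes the sum factor over the paths, and a path on \<open>l\<close> vertices
  contributes \<open>1\<^sup>T \<Phi>\<^sup>l\<^sup>-\<^sup>1 1 \<le> N \<parallel>\<Phi>\<parallel>\<^sup>l\<^sup>-\<^sup>1\<close>. Since \<open>\<parallel>\<Phi>\<parallel> \<le> N \<parallel>\<Phi>\<parallel>\<^sub>\<infinity>\<close>, it suffices to find a cover with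
  \<open>c \<le> 2 d - 2 m + |conn G|\<close>.

  Such a cover is built greedily, adding the edges one at a time and maintaining
  \<open>c \<le> |conn G| + \<Sum>\<^sub>v max 0 (deg v - 2)\<close>: a new edge that merges two components lowers the right-hand
  side only if both its ends had degree at most 1, and then they are endpoints of two
  different paths, which the edge joins.
\<close>

section \<open>Paths as vertex lists and their edge multisets\<close>

fun path_edges :: "'v list \<Rightarrow> 'v uprod multiset" where
  "path_edges (x # y # r) = add_mset (Upair x y) (path_edges (y # r))"
| "path_edges _ = {#}"

lemma path_edges_append:
  assumes "p \<noteq> []" "q \<noteq> []"
  shows "path_edges (p @ q) = add_mset (Upair (last p) (hd q)) (path_edges p + path_edges q)"
  using assms
proof (induction p rule: path_edges.induct)
  case ("2_2" v)
  then show ?case by (cases q) auto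
qed auto

lemma path_edges_rev: "path_edges (rev p) = path_edges p"
proof (induction p rule: path_edges.induct)
  case (1 x y r)
  have "path_edges (rev (y # r) @ [x]) = add_mset (Upair y x) (path_edges (y # r))"
    using 1 by (subst path_edges_append) (auto simp: last_rev)
  then show ?case by (simp add: Upair_inject insert_commute add.commute)
qed auto

lemma size_path_edges: "size (path_edges p) = length p - 1"
  by (induction p rule: path_edges.induct) auto

text \<open>A path stays within one component, so vertices of different components lie on different
  paths.\<close>

lemma path_edges_connected:
  assumes "x \<in> set p" "path_edges p \<subseteq># E"
  shows "(hd p, x) \<in> {(a, b). Upair a b \<in># E}\<^sup>*"
  using assms
proof (induction p rule: path_edges.induct)
  case (1 u v r)
  from 1(3) have e: "Upair u v \<in># E" and s: "path_edges (v # r) \<subseteq># E"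
    by (auto simp: insert_subset_eq_iff dest: subset_mset.order_trans[OF _ diff_subset_eq_self])
  show ?case
  proof (cases "x = u")
    case False
    then have "(v, x) \<in> {(a, b). Upair a b \<in># E}\<^sup>*" using 1(1)[OF _ s] 1(2) by auto
    with e show ?thesis by (auto intro: converse_rtrancl_into_rtrancl)
  qed simp
qed auto

section \<open>Incidences and degrees\<close>

definition incidence :: "'v \<Rightarrow> 'v uprod \<Rightarrow> nat" where
  "incidence v e = (if e = Upair v v then 2 else if v \<in> set_uprod e then 1 else 0)"

lemma degree_incidence: "degree G v = (\<Sum>e\<in>#edges G. incidence v e)"
  by (simp add: degree_def incidence_def)

lemma sum_incidence:
  assumes "finite V" "set_uprod e \<subseteq> V"
  shows "(\<Sum>v\<in>V. incidence v e) = 2"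
proof -
  obtain x y where Pair: "e = Upair x y" by (cases e)
  have "(\<Sum>v\<in>V. incidence v e) = (\<Sum>v\<in>{x, y}. incidence v e)"
    using assms Pair by (intro sum.mono_neutral_right) (auto simp: incidence_def)
  also have "\<dots> = 2"
    using Pair by (cases "x = y") (auto simp: incidence_def)
  finally show ?thesis .
qed

lemma handshake:
  assumes "is_multigraph G"
  shows "(\<Sum>v\<in>verts G. degree G v) = 2 * size (edges G)"
proof -
  have "(\<Sum>v\<in>V. \<Sum>e\<in>#E. incidence v e) = 2 * size E"
    if "finite V" "\<forall>e\<in>#E. set_uprod e \<subseteq> V" for V :: "'a set" and E
    using that(2)
  proof (induction E)
    case (add e E)
    then show ?case by (simp add: sum.distrib sum_incidence[OF that(1)])
  qed simp
  with assms show ?thesis by (simp add: degree_incidence is_multigraph_def)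
qed

lemma sum_mset_incidence_mono:
  assumes "A \<subseteq># B"
  shows "(\<Sum>e\<in>#A. incidence v e) \<le> (\<Sum>e\<in>#B. incidence v e)"
  using assms by (metis image_mset_union le_add1 mset_subset_eq_exists_conv sum_mset.union)

text \<open>An interior vertex has a path edge on either side, and these two alone give it degree
  2.\<close>

lemma endpoint_if_degree_le_1:
  assumes "x \<in> set p" "path_edges p \<subseteq># E" "(\<Sum>e\<in>#E. incidence x e) \<le> 1"
  shows "x = hd p \<or> x = last p"
proof (rule ccontr)
  assume neg: "\<not> ?thesis"
  from assms(1) obtain as bs where p: "p = as @ x # bs" by (auto dest: split_list)
  with neg have ne: "as \<noteq> []" "bs \<noteq> []" by auto
  have "path_edges p = add_mset (Upair (last as) x) (path_edges as +
      add_mset (Upair x (hd bs)) (path_edges [x] + path_edges bs))"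
    using ne path_edges_append[of as "x # bs"] path_edges_append[of "[x]" bs] by (simp add: p)
  then have "2 \<le> (\<Sum>e\<in>#path_edges p. incidence x e)"
    by (auto simp: incidence_def)
  with sum_mset_incidence_mono[OF assms(2), of x] assms(3) show False by simp
qed

section \<open>Components under the addition of an edge\<close>

lemma sym_reachable: "sym ({(a, b). Upair a b \<in># E}\<^sup>*)"
proof (rule sym_rtrancl)
  show "sym {(a, b). Upair a b \<in># E}"
    by (auto simp: sym_def Upair_inject) (metis Upair_inject)
qed

lemma equiv_connected_rel: "equiv (verts G) (connected_rel G)"
  using sym_reachable[of "edges G"]
  unfolding connected_rel_def
  by (intro equivI) (auto simp: refl_on_def sym_def trans_def intro: rtrancl_trans)

lemma edge_rel_add_mset:
  "{(a, b). Upair a b \<in># add_mset (Upair x y) E} = insert (x, y) (insert (y, x) {(a, b). Upair a b \<in># E})"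
  by auto

text \<open>By \<open>merge\<close>, two different \<open>R\<close>-classes can fall into the same
  \<open>R'\<close>-class only if one of them is the class of \<open>y\<close>. Away from that
  class, the map from \<open>R\<close>-classes to \<open>R'\<close>-classes is therefore
  injective.\<close>

lemma card_quotient_merge:
  assumes V: "finite V" and R: "equiv V R" and R': "equiv V R'" and sub: "R \<subseteq> R'"
    and merge: "\<And>a b. (a, b) \<in> R' \<Longrightarrow> (a, b) \<in> R \<or> (a, y) \<in> R \<or> (b, y) \<in> R"
  shows "card (V // R) \<le> card (V // R') + 1"
proof -
  have fin: "finite (V // R)" "finite (V // R')"
    using finite_quotient[OF V] equiv_type[OF R] equiv_type[OF R'] by auto
  \<comment> \<open>Sending an \<open>R\<close>-class to the \<open>R'\<close>-class around it does
    not depend on a representative.\<close>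
  have img: "R' `` (R `` {a}) = R' `` {a}" if "a \<in> V" for a
  proof
    have tr: "trans R'" using R' by (simp add: equiv_def)
    show "R' `` (R `` {a}) \<subseteq> R' `` {a}" using sub transD[OF tr] by blast
    have "(a, a) \<in> R" using R that by (simp add: equiv_def refl_on_def)
    then show "R' `` {a} \<subseteq> R' `` (R `` {a})" by blast
  qed
  have "inj_on (\<lambda>C. R' `` C) (V // R - {R `` {y}})"
  proof (rule inj_onI)
    fix C D assume C: "C \<in> V // R - {R `` {y}}" and D: "D \<in> V // R - {R `` {y}}"
      and eq: "R' `` C = R' `` D"
    from C D obtain a b where ab: "a \<in> V" "b \<in> V" "C = R `` {a}" "D = R `` {b}"
      by (auto elim!: quotientE)
    with eq have "(a, b) \<in> R'" using img R' by (metis eq_equiv_class)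
    moreover have "(a, y) \<notin> R" "(b, y) \<notin> R"
      using C D ab R by (auto dest: equiv_class_eq)
    ultimately have "(a, b) \<in> R" using merge by blast
    then show "C = D" using ab R by (simp add: equiv_class_eq)
  qed
  moreover have "(\<lambda>C. R' `` C) ` (V // R - {R `` {y}}) \<subseteq> V // R'"
    using img by (auto elim!: quotientE intro: quotientI)
  ultimately have "card (V // R - {R `` {y}}) \<le> card (V // R')"
    using fin by (metis card_inj_on_le)
  moreover have "card (V // R) \<le> card (V // R - {R `` {y}}) + 1"
    using diff_card_le_card_Diff[of "{R `` {y}}" "V // R"] by simp
  ultimately show ?thesis by linarith
qed

lemma card_conn_add_edge:
  fixes V :: "'v set"
  assumes "finite V" "y \<in> V"
  shows "card (conn \<lparr>verts = V, edges = E\<rparr>)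
    \<le> card (conn \<lparr>verts = V, edges = add_mset (Upair x y) E\<rparr>) + 1"
  unfolding conn_def multigraph.simps
proof (rule card_quotient_merge[where y = y])
  let ?G = "\<lparr>verts = V, edges = E\<rparr>" and ?G' = "\<lparr>verts = V, edges = add_mset (Upair x y) E\<rparr>"
  let ?S = "{(a, b). Upair a b \<in># E}"
  show "finite V" by (fact assms(1))
  show "equiv V (connected_rel ?G)" "equiv V (connected_rel ?G')"
    using equiv_connected_rel[of ?G] equiv_connected_rel[of ?G'] by simp_all
  have "?S\<^sup>* \<subseteq> {(a, b). Upair a b \<in># add_mset (Upair x y) E}\<^sup>*"
    by (intro rtrancl_mono) auto
  then show "connected_rel ?G \<subseteq> connected_rel ?G'" by (auto simp: connected_rel_def)
  fix a b assume ab: "(a, b) \<in> connected_rel ?G'"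
  \<comment> \<open>If a walk from \<open>a\<close> to \<open>b\<close> needs the new edge, cutting
    it at that edge leaves \<open>a\<close> or \<open>b\<close> connected to \<open>y\<close> by old
    edges.\<close>
  show "(a, b) \<in> connected_rel ?G \<or> (a, y) \<in> connected_rel ?G \<or> (b, y) \<in> connected_rel ?G"
    using ab sym_reachable[of E] \<open>y \<in> V\<close>
    unfolding connected_rel_def multigraph.simps edge_rel_add_mset
    by (auto simp: rtrancl_insert sym_def intro: rtrancl_trans)
qed

section \<open>Path covers\<close>

text \<open>One-vertex lists count as paths without edges. Excluding \<open>[]\<close> makes a path
  on \<open>l\<close> vertices have exactly \<open>l - 1\<close> edges. The multiset inclusion
  ensures that no copy of a parallel edge is used twice.\<close>

definition path_cover :: "'v set \<Rightarrow> 'v uprod multiset \<Rightarrow> 'v list set \<Rightarrow> bool" where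
  "path_cover V E P \<longleftrightarrow> finite P \<and> [] \<notin> P \<and> (\<forall>p\<in>P. distinct p) \<and>
     disjoint_family_on set P \<and> \<Union> (set ` P) = V \<and> (\<Sum>p\<in>P. path_edges p) \<subseteq># E"


text \<open>Reversing a path keeps its vertices and its unordered edges. So \<open>p\<close> can be
  made to end at \<open>x\<close> and \<open>q\<close> to start at \<open>y\<close>, and the new
  edge turns their concatenation into one path.\<close>

lemma path_cover_join:
  assumes P: "path_cover V E P" and pq: "p \<in> P" "q \<in> P" "p \<noteq> q"
    and xy: "x = hd p \<or> x = last p" "y = hd q \<or> y = last q"
  shows "\<exists>P'. path_cover V (add_mset (Upair x y) E) P' \<and> card P = card P' + 1"
proof -
  have fin: "finite P" and ne: "[] \<notin> P" and dist: "\<And>p. p \<in> P \<Longrightarrow> distinct p"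
    and disj: "\<And>p q. p \<in> P \<Longrightarrow> q \<in> P \<Longrightarrow> p \<noteq> q \<Longrightarrow> set p \<inter> set q = {}"
    and U: "\<Union> (set ` P) = V" and sub: "(\<Sum>p\<in>P. path_edges p) \<subseteq># E"
    using P by (auto simp: path_cover_def disjoint_family_on_def)
  have pne: "p \<noteq> []" "q \<noteq> []" using ne pq by auto
  obtain p' where p': "p' \<noteq> []" "set p' = set p" "distinct p'" "last p' = x"
    "path_edges p' = path_edges p"
    using xy(1) dist[OF pq(1)] pne(1) path_edges_rev[of p]
    by (metis distinct_rev last_rev rev_is_Nil_conv set_rev)
  obtain q' where q': "q' \<noteq> []" "set q' = set q" "distinct q'" "hd q' = y"
    "path_edges q' = path_edges q"
    using xy(2) dist[OF pq(2)] pne(2) path_edges_rev[of q]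
    by (metis distinct_rev hd_rev rev_is_Nil_conv set_rev)
  define r where "r = p' @ q'"
  let ?Q = "P - {p, q}"
  have r: "r \<noteq> []" "distinct r" "set r = set p \<union> set q"
    using p' q' disj[OF pq] by (auto simp: r_def)
  have er: "path_edges r = add_mset (Upair x y) (path_edges p + path_edges q)"
    unfolding r_def using p' q' by (simp add: path_edges_append)
  have rQ: "set r \<inter> set s = {}" if "s \<in> ?Q" for s
    using that disj[of p s] disj[of q s] pq r(3) by auto
  \<comment> \<open>A nonempty list disjoint from all remaining paths is not one of them, so
    replacing \<open>p\<close> and \<open>q\<close> by \<open>r\<close> lowers the count by exactly
    1.\<close>
  then have "r \<notin> ?Q" using r(1) by fastforce
  moreover have Peq: "P = insert p (insert q ?Q)" using pq by auto
  have "card P = card ?Q + 2"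
    using fin pq by (subst Peq) (simp add: card_insert_if)
  ultimately have card: "card P = card (insert r ?Q) + 1" using fin by simp
  have "(\<Sum>p\<in>P. path_edges p) = path_edges p + (path_edges q + (\<Sum>p\<in>?Q. path_edges p))"
    using fin pq by (subst Peq) simp
  then have "(\<Sum>p\<in>insert r ?Q. path_edges p) = add_mset (Upair x y) (\<Sum>p\<in>P. path_edges p)"
    using fin \<open>r \<notin> ?Q\<close> er by (simp add: add.assoc)
  with sub have "(\<Sum>p\<in>insert r ?Q. path_edges p) \<subseteq># add_mset (Upair x y) E" by simp
  moreover have "\<Union> (set ` insert r ?Q) = V"
    using U r(3) pq by auto
  moreover have "disjoint_family_on set (insert r ?Q)"
    using disj rQ unfolding disjoint_family_on_def by (auto simp: Int_commute)
  ultimately have "path_cover V (add_mset (Upair x y) E) (insert r ?Q)"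
    using fin ne dist r unfolding path_cover_def by auto
  with card show ?thesis by blast
qed

lemma path_cover_add_mset:
  assumes "path_cover V E P"
  shows "path_cover V (add_mset e E) P"
  using assms unfolding path_cover_def
  by (auto intro: subset_mset.order_trans)

lemma conn_add_edge_connected:
  assumes "(x, y) \<in> {(a, b). Upair a b \<in># E}\<^sup>*"
  shows "conn \<lparr>verts = V, edges = add_mset (Upair x y) E\<rparr> = conn \<lparr>verts = V, edges = E\<rparr>"
proof -
  let ?S = "{(a, b). Upair a b \<in># E}"
  have "(y, x) \<in> ?S\<^sup>*" using assms sym_reachable[of E] by (auto simp: sym_def)
  with assms have "(insert (x, y) (insert (y, x) ?S))\<^sup>* = ?S\<^sup>*"
    by (auto simp: rtrancl_insert intro: rtrancl_trans)
  then show ?thesis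
    by (simp only: conn_def connected_rel_def multigraph.simps edge_rel_add_mset)
qed

text \<open>Vertices of degree below 2 do occur while edges are being added; truncated subtraction
  gives them excess 0. The vertex set stays fixed throughout.\<close>

lemma exists_path_cover:
  assumes "finite V" "\<forall>e\<in>#E. set_uprod e \<subseteq> V"
  shows "\<exists>P. path_cover V E P \<and>
    card P \<le> card (conn \<lparr>verts = V, edges = E\<rparr>) + (\<Sum>v\<in>V. degree \<lparr>verts = V, edges = E\<rparr> v - 2)"
  using assms(2)
proof (induction E)
  case empty
  \<comment> \<open>Without edges, every vertex is both a component and a one-vertex path, and there
    is no excess.\<close>
  let ?P = "(\<lambda>v. [v]) ` V"
  have "connected_rel \<lparr>verts = V, edges = {#}\<rparr> = Id_on V"
    by (auto simp: connected_rel_def)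
  then have "conn \<lparr>verts = V, edges = {#}\<rparr> = (\<lambda>v. {v}) ` V"
    by (auto simp: conn_def quotient_def)
  then have "card (conn \<lparr>verts = V, edges = {#}\<rparr>) = card V"
    by (simp add: card_image inj_on_def)
  moreover have "card ?P = card V" by (simp add: card_image inj_on_def)
  moreover have "path_cover V {#} ?P"
    using assms(1) by (auto simp: path_cover_def disjoint_family_on_def sum.reindex inj_on_def)
  ultimately show ?case by (intro exI[of _ ?P]) simp
next
  case (add e E)
  then obtain P where P: "path_cover V E P"
    and card: "card P \<le> card (conn \<lparr>verts = V, edges = E\<rparr>)
      + (\<Sum>v\<in>V. degree \<lparr>verts = V, edges = E\<rparr> v - 2)" by auto
  obtain x y where e: "e = Upair x y" by (cases e)
  with add.prems have xy: "x \<in> V" "y \<in> V" by auto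
  let ?S = "{(a, b). Upair a b \<in># E}"
  let ?d = "degree \<lparr>verts = V, edges = E\<rparr>" and ?d' = "degree \<lparr>verts = V, edges = add_mset e E\<rparr>"
  have d': "?d' v = incidence v e + ?d v" for v by (simp add: degree_incidence)
  have excess: "(\<Sum>v\<in>V. ?d v - 2) \<le> (\<Sum>v\<in>V. ?d' v - 2)"
    by (intro sum_mono) (simp add: d')
  note P' = path_cover_add_mset[OF P, of e]
  show ?case
  proof (cases "(x, y) \<in> ?S\<^sup>*")
    case True
    \<comment> \<open>An edge inside a component leaves the components as they are, so the old cover
      still satisfies the bound.\<close>
    with card excess P' show ?thesis
      by (intro exI[of _ P]) (simp add: e conn_add_edge_connected)
  next
    case nconn: False
    have conn1: "card (conn \<lparr>verts = V, edges = E\<rparr>)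
        \<le> card (conn \<lparr>verts = V, edges = add_mset e E\<rparr>) + 1"
      unfolding e by (rule card_conn_add_edge[OF assms(1) xy(2)])
    show ?thesis
    \<comment> \<open>At most one component is lost. Either two paths are joined to make up for it,
      or an end of degree at least 2 raises the excess.\<close>
    proof (cases "?d x \<le> 1 \<and> ?d y \<le> 1")
      case True
      obtain p q where p: "p \<in> P" "x \<in> set p" and q: "q \<in> P" "y \<in> set q"
        using P xy unfolding path_cover_def by blast
      have sub: "path_edges r \<subseteq># E" if "r \<in> P" for r
      proof -
        have "(\<Sum>p\<in>P. path_edges p) = path_edges r + (\<Sum>p\<in>P - {r}. path_edges p)"
          using that P by (intro sum.remove) (auto simp: path_cover_def)
        then have "path_edges r \<subseteq># (\<Sum>p\<in>P. path_edges p)" by simp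
        then show ?thesis using P unfolding path_cover_def by (blast intro: subset_mset.order_trans)
      qed
      \<comment> \<open>A common path would already connect \<open>x\<close> and \<open>y\<close>
        through its first vertex.\<close>
      have "p \<noteq> q"
      proof
        assume "p = q"
        have "(x, hd p) \<in> ?S\<^sup>*"
          using path_edges_connected[OF p(2) sub[OF p(1)]] sym_reachable[of E] by (auto simp: sym_def)
        also have "(hd p, y) \<in> ?S\<^sup>*"
          using path_edges_connected[OF q(2) sub[OF q(1)]] \<open>p = q\<close> by simp
        finally show False using nconn by simp
      qed
      moreover have "x = hd p \<or> x = last p" "y = hd q \<or> y = last q"
        using True endpoint_if_degree_le_1[OF p(2) sub[OF p(1)]]
          endpoint_if_degree_le_1[OF q(2) sub[OF q(1)]] by (simp_all add: degree_incidence)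
      ultimately obtain Q where "path_cover V (add_mset e E) Q" "card P = card Q + 1"
        using path_cover_join[OF P p(1) q(1)] unfolding e by blast
      with card conn1 excess show ?thesis by (intro exI[of _ Q]) simp
    next
      case False
      then obtain z where z: "z \<in> V" "z \<in> {x, y}" "2 \<le> ?d z" using xy by fastforce
      have "?d z - 2 < ?d' z - 2" 
      proof -
        have "0 < incidence z e" using z(2) by (auto simp: e incidence_def)
        then show ?thesis using z(3) by (simp add: d')
      qed
      \<comment> \<open>At \<open>z\<close> the truncation is not active, so the extra incidence
        shows up in the sum; no other term decreases.\<close>
      then have "(\<Sum>v\<in>V. ?d v - 2) < (\<Sum>v\<in>V. ?d' v - 2)"
        using z assms(1) by (intro sum_strict_mono_ex1) (auto simp: d')
      with card conn1 P' show ?thesis by (intro exI[of _ P]) simp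
    qed
  qed
qed


section \<open>Summing path weights over labellings\<close>

lemma sum_PiE_insert:
  assumes "x \<notin> S"
  shows "(\<Sum>i\<in>insert x S \<rightarrow>\<^sub>E T. h i) = (\<Sum>a\<in>T. \<Sum>i\<in>S \<rightarrow>\<^sub>E T. h (i(x := a)))"
  unfolding PiE_insert_eq
  by (subst sum.reindex[OF inj_combinator[OF assms]])
    (simp add: sum.cartesian_product case_prod_unfold)

lemma sum_PiE_Un:
  assumes "A \<inter> B = {}"
  shows "(\<Sum>i\<in>A \<union> B \<rightarrow>\<^sub>E T. h i) =
    (\<Sum>j\<in>A \<rightarrow>\<^sub>E T. \<Sum>k\<in>B \<rightarrow>\<^sub>E T. h (\<lambda>x. if x \<in> A then j x else k x))"
  unfolding sum.cartesian_product
\<comment> \<open>Restriction to \<open>A\<close> and \<open>B\<close> is inverse to gluing, because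
  extensional functions have a fixed value outside their domain.\<close>
proof (rule sum.reindex_bij_witness[where
        i = "\<lambda>(j, k) x. if x \<in> A then j x else k x" and
        j = "\<lambda>i. (restrict i A, restrict i B)"])
  fix i assume i: "i \<in> A \<union> B \<rightarrow>\<^sub>E T"
  have eq: "(\<lambda>x. if x \<in> A then restrict i A x else restrict i B x) = i"
    using i by (auto simp: fun_eq_iff PiE_def extensional_def)
  then show "(case (restrict i A, restrict i B) of (j, k) \<Rightarrow> \<lambda>x. if x \<in> A then j x else k x) = i"
    by simp
  show "(restrict i A, restrict i B) \<in> (A \<rightarrow>\<^sub>E T) \<times> (B \<rightarrow>\<^sub>E T)"
    using i by auto
  show "(case (restrict i A, restrict i B) of (j, k) \<Rightarrow> h (\<lambda>x. if x \<in> A then j x else k x)) = h i"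
    using eq by simp
next
  fix jk assume "jk \<in> (A \<rightarrow>\<^sub>E T) \<times> (B \<rightarrow>\<^sub>E T)"
  then obtain j k where jk: "jk = (j, k)" "j \<in> A \<rightarrow>\<^sub>E T" "k \<in> B \<rightarrow>\<^sub>E T" by auto
  let ?i = "\<lambda>x. if x \<in> A then j x else k x"
  have "restrict ?i A = j" "restrict ?i B = k"
    using jk assms by (auto simp: fun_eq_iff PiE_def extensional_def)
  then show "(restrict (case jk of (j, k) \<Rightarrow> \<lambda>x. if x \<in> A then j x else k x) A,
      restrict (case jk of (j, k) \<Rightarrow> \<lambda>x. if x \<in> A then j x else k x) B) = jk"
    by (simp add: jk)
  show "(case jk of (j, k) \<Rightarrow> \<lambda>x. if x \<in> A then j x else k x) \<in> A \<union> B \<rightarrow>\<^sub>E T"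
    using jk by (auto simp: PiE_def extensional_def)
qed

text \<open>Entries are read in the order of the list, so that the recursion matches multiplication
  of a vector by \<open>\<Phi>\<close>; symmetry of \<open>\<Phi>\<close> then links this to
  \<open>entry\<close>.\<close>

fun path_weight :: "real ^ 'n ^ 'n \<Rightarrow> ('v \<Rightarrow> 'n) \<Rightarrow> 'v list \<Rightarrow> real" where
  "path_weight \<Phi> i (x # y # r) = \<Phi> $ i x $ i y * path_weight \<Phi> i (y # r)"
| "path_weight \<Phi> i _ = 1"

lemma path_weight_eq_prod_entry:
  assumes "transpose \<Phi> = \<Phi>"
  shows "path_weight \<Phi> i p = (\<Prod>e\<in>#path_edges p. entry \<Phi> (map_uprod i e))"
  by (induction p rule: path_edges.induct) (simp_all add: entry_Upair[OF assms])

lemma path_weight_cong: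
  "(\<And>x. x \<in> set p \<Longrightarrow> i x = j x) \<Longrightarrow> path_weight \<Phi> i p = path_weight \<Phi> j p"
  by (induction p rule: path_edges.induct) auto

lemma path_weight_nonneg:
  assumes "\<And>a b. 0 \<le> \<Phi> $ a $ b"
  shows "0 \<le> path_weight \<Phi> i p"
  by (induction p rule: path_edges.induct) (simp_all add: assms)

text \<open>Transfer matrix argument: summing out the label of each further vertex applies
  \<open>\<Phi>\<close> once, starting from the all-ones vector \<open>1\<close>. The arbitrary
  weight \<open>u\<close> on the first label is what lets the induction pass.\<close>

lemma sum_path_weight_vec:
  fixes \<Phi> :: "real ^ 'n ^ 'n"
  assumes "distinct (x # r)"
  shows "(\<Sum>i\<in>set (x # r) \<rightarrow>\<^sub>E UNIV. u (i x) * path_weight \<Phi> i (x # r)) =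
    (\<Sum>a\<in>UNIV. u a * (((*v) \<Phi> ^^ length r) 1) $ a)"
  using assms
proof (induction r arbitrary: x u)
  case Nil
  show ?case by (simp add: sum_PiE_insert)
next
  case (Cons y r)
  have upd: "path_weight \<Phi> (i(x := a)) (y # r) = path_weight \<Phi> i (y # r)" for i a
    using Cons.prems by (intro path_weight_cong) auto
  let ?w = "((*v) \<Phi> ^^ length r) 1"
  have "(\<Sum>i\<in>set (x # y # r) \<rightarrow>\<^sub>E UNIV. u (i x) * path_weight \<Phi> i (x # y # r))
    = (\<Sum>i\<in>insert x (set (y # r)) \<rightarrow>\<^sub>E UNIV. u (i x) * path_weight \<Phi> i (x # y # r))"
    by simp
  also have "\<dots> = (\<Sum>a\<in>UNIV. \<Sum>i\<in>set (y # r) \<rightarrow>\<^sub>E UNIV. u a * \<Phi> $ a $ i y * path_weight \<Phi> i (y # r))"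
    using Cons.prems upd by (subst sum_PiE_insert) (auto simp: mult.assoc)
  also have "\<dots> = (\<Sum>a\<in>UNIV. \<Sum>b\<in>UNIV. u a * \<Phi> $ a $ b * ?w $ b)"
    \<comment> \<open>For a fixed label \<open>a\<close> of \<open>x\<close>, the row entries of
      \<open>\<Phi>\<close> at \<open>a\<close> are absorbed into the weight on the label of
      \<open>y\<close>.\<close>
    using Cons.prems by (intro sum.cong refl Cons.IH[where u = "\<lambda>b. u _ * \<Phi> $ _ $ b"]) auto
  also have "\<dots> = (\<Sum>a\<in>UNIV. u a * (\<Phi> *v ?w) $ a)"
    by (simp add: matrix_vector_mult_def sum_distrib_left mult.assoc)
  finally show ?case by simp
qed

lemma norm_matrix_vector_mult_le: "norm (\<Phi> *v v) \<le> spectral_norm \<Phi> * norm v"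
  unfolding spectral_norm_def by (rule onorm) (rule matrix_vector_mul_bounded_linear)

lemma spectral_norm_nonneg: "0 \<le> spectral_norm \<Phi>"
  unfolding spectral_norm_def by (rule onorm_pos_le) (rule matrix_vector_mul_bounded_linear)

text \<open>The sum is the inner product of the all-ones vector with its image under a power of
  \<open>\<Phi>\<close>. By Cauchy-Schwarz its norm, the square root of N, enters twice and yields
  the factor N.\<close>

lemma sum_path_weight_le:
  fixes \<Phi> :: "real ^ 'n ^ 'n"
  assumes "distinct p" "p \<noteq> []"
  shows "(\<Sum>i\<in>set p \<rightarrow>\<^sub>E UNIV. path_weight \<Phi> i p)
    \<le> real CARD('n) * spectral_norm \<Phi> ^ (length p - 1)"
proof -
  obtain x r where p: "p = x # r" using assms(2) by (cases p) auto
  let ?s = "spectral_norm \<Phi>"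
  have n1: "norm (1 :: real ^ 'n) = sqrt (real CARD('n))"
    by (simp add: norm_vec_def L2_set_def)
  have norm: "norm (((*v) \<Phi> ^^ k) 1) \<le> ?s ^ k * norm (1 :: real ^ 'n)" for k
  proof (induction k)
    case (Suc k)
    have "norm (((*v) \<Phi> ^^ Suc k) 1) \<le> ?s * norm (((*v) \<Phi> ^^ k) 1)"
      by (simp add: norm_matrix_vector_mult_le)
    also have "\<dots> \<le> ?s * (?s ^ k * norm (1 :: real ^ 'n))"
      using Suc spectral_norm_nonneg by (rule mult_left_mono)
    finally show ?case by simp
  qed simp
  have "(\<Sum>i\<in>set p \<rightarrow>\<^sub>E UNIV. path_weight \<Phi> i p) = 1 \<bullet> (((*v) \<Phi> ^^ length r) 1)"
    using sum_path_weight_vec[of x r "\<lambda>_. 1" \<Phi>] assms by (simp add: p inner_vec_def)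
  also have "\<dots> \<le> norm (1 :: real ^ 'n) * norm (((*v) \<Phi> ^^ length r) 1)"
    by (rule norm_cauchy_schwarz)
  also have "\<dots> \<le> norm (1 :: real ^ 'n) * (?s ^ length r * norm (1 :: real ^ 'n))"
    by (intro mult_left_mono norm) simp
  also have "\<dots> = real CARD('n) * ?s ^ length r"
    by (simp add: n1 mult.assoc[symmetric] mult.commute)
  finally show ?thesis by (simp add: p)
qed

text \<open>The paths share no vertex, so a labelling of their union is an independent choice on
  each path, and the sum factors.\<close>

lemma sum_prod_path_weight_le:
  fixes \<Phi> :: "real ^ 'n ^ 'n"
  assumes nonneg: "\<And>a b. 0 \<le> \<Phi> $ a $ b"
    and "finite P" "[] \<notin> P" "\<forall>p\<in>P. distinct p" "disjoint_family_on set P"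
  shows "(\<Sum>i\<in>\<Union> (set ` P) \<rightarrow>\<^sub>E UNIV. \<Prod>p\<in>P. path_weight \<Phi> i p)
    \<le> (\<Prod>p\<in>P. real CARD('n) * spectral_norm \<Phi> ^ (length p - 1))"
  using assms(2-)
proof (induction P)
  case (insert p P)
  let ?U = "\<Union> (set ` P)" and ?B = "\<lambda>p. real CARD('n) * spectral_norm \<Phi> ^ (length p - 1)"
  have disj: "set p \<inter> ?U = {}" and P: "disjoint_family_on set P"
    using insert.prems insert.hyps by (auto simp: disjoint_family_on_def)
  have p: "path_weight \<Phi> (\<lambda>x. if x \<in> set p then j x else k x) p = path_weight \<Phi> j p" for j k
    by (rule path_weight_cong) simp
  have q: "path_weight \<Phi> (\<lambda>x. if x \<in> set p then j x else k x) q = path_weight \<Phi> k q"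
    if "q \<in> P" for j k q
    using that disj by (intro path_weight_cong) auto
  have "(\<Sum>i\<in>\<Union> (set ` insert p P) \<rightarrow>\<^sub>E UNIV. \<Prod>p\<in>insert p P. path_weight \<Phi> i p)
    = (\<Sum>i\<in>set p \<union> ?U \<rightarrow>\<^sub>E UNIV. path_weight \<Phi> i p * (\<Prod>p\<in>P. path_weight \<Phi> i p))"
    using insert.hyps by simp
  also have "\<dots> = (\<Sum>j\<in>set p \<rightarrow>\<^sub>E UNIV. \<Sum>k\<in>?U \<rightarrow>\<^sub>E UNIV.
      path_weight \<Phi> j p * (\<Prod>p\<in>P. path_weight \<Phi> k p))"
    by (subst sum_PiE_Un[OF disj]) (simp add: p q)
  also have "\<dots> = (\<Sum>j\<in>set p \<rightarrow>\<^sub>E UNIV. path_weight \<Phi> j p) *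
      (\<Sum>k\<in>?U \<rightarrow>\<^sub>E UNIV. \<Prod>p\<in>P. path_weight \<Phi> k p)"
    by (simp add: sum_product)
  also have "\<dots> \<le> ?B p * (\<Prod>p\<in>P. ?B p)"
    using insert P nonneg
    by (intro mult_mono sum_path_weight_le) (auto intro!: sum_nonneg prod_nonneg path_weight_nonneg
        mult_nonneg_nonneg zero_le_power spectral_norm_nonneg)
  finally show ?case using insert.hyps by simp
qed simp

section \<open>Comparison of the two norms\<close>

lemma abs_entry_le_linf_norm: "\<bar>\<Phi> $ i $ j\<bar> \<le> linf_norm \<Phi>"
proof -
  have "{\<bar>\<Phi> $ i $ j\<bar> | i j. True} = (\<lambda>(i, j). \<bar>\<Phi> $ i $ j\<bar>) ` UNIV" by auto
  then have "finite {\<bar>\<Phi> $ i $ j\<bar> | i j. True}" by simp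
  then show ?thesis unfolding linf_norm_def by (rule Max_ge) auto
qed

lemma spectral_norm_pos:
  assumes "\<Phi> \<noteq> 0"
  shows "0 < spectral_norm \<Phi>"
proof -
  have "(*v) \<Phi> \<noteq> (\<lambda>_. 0)"
    using assms by (metis matrix_eq matrix_vector_mult_0)
  then show ?thesis
    unfolding spectral_norm_def
    by (subst onorm_pos_lt[OF matrix_vector_mul_bounded_linear]) auto
qed

text \<open>Each row has norm at most \<open>sqrt ?N * ?M\<close>, which bounds every coordinate of
  the image by Cauchy-Schwarz; collecting the N coordinates gives the second factor
  \<open>sqrt ?N\<close>.\<close>

lemma spectral_norm_le_linf_norm:
  fixes \<Phi> :: "real ^ 'n ^ 'n"
  shows "spectral_norm \<Phi> \<le> real CARD('n) * linf_norm \<Phi>"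
  unfolding spectral_norm_def
proof (rule onorm_le)
  fix v :: "real ^ 'n"
  let ?N = "real CARD('n)" and ?M = "linf_norm \<Phi>"
  \<comment> \<open>Any entry witnesses this, so the indices are arbitrary.\<close>
  have M: "0 \<le> ?M" using abs_entry_le_linf_norm[of \<Phi> undefined undefined] by linarith
  have row: "norm (\<Phi> $ i) \<le> sqrt ?N * ?M" for i
  proof -
    have "norm (\<Phi> $ i) \<le> sqrt (\<Sum>j\<in>(UNIV :: 'n set). ?M\<^sup>2)"
      unfolding norm_vec_def L2_set_def
      by (intro real_sqrt_le_mono sum_mono) (use abs_entry_le_linf_norm M in \<open>simp add: abs_le_square_iff[symmetric]\<close>)
    then show ?thesis using M by (simp add: real_sqrt_mult)
  qed
  have "norm (\<Phi> *v v) \<le> sqrt (\<Sum>i\<in>(UNIV :: 'n set). (sqrt ?N * ?M * norm v)\<^sup>2)"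
    unfolding norm_vec_def[of "\<Phi> *v v"] L2_set_def
  proof (intro real_sqrt_le_mono sum_mono power_mono)
    fix i
    have "norm ((\<Phi> *v v) $ i) \<le> norm (\<Phi> $ i) * norm v"
      by (simp add: matrix_mult_dot Cauchy_Schwarz_ineq2)
    also have "\<dots> \<le> sqrt ?N * ?M * norm v" by (intro mult_right_mono row) simp
    finally show "norm ((\<Phi> *v v) $ i) \<le> sqrt ?N * ?M * norm v" .
  qed simp
  also have "\<dots> = ?N * ?M * norm v"
    using M by (simp add: real_sqrt_mult)
  finally show "norm (\<Phi> *v v) \<le> ?N * ?M * norm v" .
qed


section \<open>From a path cover to a bound on \<open>f_tilde\<close>\<close>

lemma entry_nonneg_le_linf_norm:
  assumes "transpose \<Phi> = \<Phi>" "\<And>i j. 0 \<le> \<Phi> $ i $ j"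
  shows "0 \<le> entry \<Phi> u" "entry \<Phi> u \<le> linf_norm \<Phi>"
proof -
  obtain a b where "u = Upair a b" by (cases u)
  then show "0 \<le> entry \<Phi> u" "entry \<Phi> u \<le> linf_norm \<Phi>"
    using assms abs_entry_le_linf_norm[of \<Phi> a b] by (simp_all add: entry_Upair)
qed

lemma prod_mset_le_power:
  fixes f :: "'b \<Rightarrow> real"
  assumes "\<And>x. 0 \<le> f x" "\<And>x. f x \<le> B"
  shows "(\<Prod>x\<in>#A. f x) \<le> B ^ size A"
proof (induction A)
  case (add x A)
  have "0 \<le> (\<Prod>x\<in>#A. f x)" using assms(1) by (induction A) auto
  then show ?case
    using add assms order_trans[OF assms] by (simp add: mult_mono)
qed simp

lemma prod_mset_sum:
  fixes f :: "'b \<Rightarrow> 'c :: comm_monoid_mult"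
  assumes "finite P"
  shows "(\<Prod>e\<in>#(\<Sum>p\<in>P. A p). f e) = (\<Prod>p\<in>P. \<Prod>e\<in>#A p. f e)"
  using assms by (induction P) simp_all

text \<open>Here \<open>t\<close> counts the edges outside the cover. Its equation is additive to
  avoid truncated subtraction.\<close>

lemma f_tilde_le_path_cover:
  fixes \<Phi> :: "real ^ 'n ^ 'n" and G :: "'v multigraph"
  assumes sym: "transpose \<Phi> = \<Phi>" and nonneg: "\<And>i j. 0 \<le> \<Phi> $ i $ j"
    and P: "path_cover (verts G) (edges G) P"
  obtains t where "t + card (verts G) = size (edges G) + card P" "card P \<le> card (verts G)"
    "f_tilde G \<Phi> \<le> real CARD('n) ^ card P * spectral_norm \<Phi> ^ (card (verts G) - card P)
      * linf_norm \<Phi> ^ t"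
proof -
  let ?M = "linf_norm \<Phi>" and ?s = "spectral_norm \<Phi>" and ?N = "real CARD('n)"
  let ?L = "\<Sum>p\<in>P. path_edges p"
  have fin: "finite P" and ne: "[] \<notin> P" and dist: "\<forall>p\<in>P. distinct p"
    and disj: "disjoint_family_on set P"
    and U: "\<Union> (set ` P) = verts G" and sub: "?L \<subseteq># edges G"
    using P by (auto simp: path_cover_def)
  \<comment> \<open>\<open>R\<close> holds the edges outside the cover, with multiplicity.\<close>
  obtain R where R: "edges G = ?L + R" using sub by (auto simp: mset_subset_eq_exists_conv)
  have "card (verts G) = (\<Sum>p\<in>P. card (set p))"
    unfolding U[symmetric] using fin disj
    by (intro card_UN_disjoint) (auto simp: disjoint_family_on_def)
  also have "\<dots> = (\<Sum>p\<in>P. (length p - 1) + 1)"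
  proof (rule sum.cong)
    fix p assume "p \<in> P"
    with dist ne show "card (set p) = (length p - 1) + 1" by (cases p) (auto simp: distinct_card)
  qed simp
  also have "\<dots> = (\<Sum>p\<in>P. length p - 1) + card P" by (subst sum.distrib) simp
  finally have cardV: "card (verts G) = (\<Sum>p\<in>P. length p - 1) + card P" .
  have "size ?L = (\<Sum>p\<in>P. length p - 1)"
    using fin by (induction P) (simp_all add: size_path_edges)
  then have size: "size R + card (verts G) = size (edges G) + card P"
    by (simp add: R cardV)
  have M: "0 \<le> ?M" using abs_entry_le_linf_norm[of \<Phi> undefined undefined] by linarith
  \<comment> \<open>Edges on the paths keep their entries, and each edge of \<open>R\<close> is
    bounded by \<open>?M\<close>.\<close>
  have pointwise: "(\<Prod>e\<in>#edges G. entry \<Phi> (map_uprod i e)) \<le> (\<Prod>p\<in>P. path_weight \<Phi> i p) * ?M ^ size R"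
    for i
  proof -
    have "(\<Prod>e\<in>#edges G. entry \<Phi> (map_uprod i e)) =
      (\<Prod>p\<in>P. path_weight \<Phi> i p) * (\<Prod>e\<in>#R. entry \<Phi> (map_uprod i e))"
      by (simp add: R prod_mset_sum[OF fin] path_weight_eq_prod_entry[OF sym])
    also have "\<dots> \<le> (\<Prod>p\<in>P. path_weight \<Phi> i p) * ?M ^ size R"
      by (intro mult_left_mono prod_mset_le_power prod_nonneg ballI path_weight_nonneg nonneg
          entry_nonneg_le_linf_norm sym)
    finally show ?thesis .
  qed
  have "f_tilde G \<Phi> \<le> (\<Sum>i\<in>verts G \<rightarrow>\<^sub>E UNIV. (\<Prod>p\<in>P. path_weight \<Phi> i p) * ?M ^ size R)"
    unfolding f_tilde_def by (intro sum_mono pointwise)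
  also have "\<dots> = (\<Sum>i\<in>\<Union> (set ` P) \<rightarrow>\<^sub>E UNIV. \<Prod>p\<in>P. path_weight \<Phi> i p) * ?M ^ size R"
    by (simp add: U sum_distrib_right)
  also have "\<dots> \<le> (\<Prod>p\<in>P. ?N * ?s ^ (length p - 1)) * ?M ^ size R"
    using M by (intro mult_right_mono sum_prod_path_weight_le[OF nonneg fin ne dist disj]) simp
  also have "\<dots> = ?N ^ card P * ?s ^ (card (verts G) - card P) * ?M ^ size R"
    by (simp add: prod.distrib power_sum cardV)
  finally show ?thesis using that[OF size] cardV by simp
qed

section \<open>Choice of exponents and conclusion\<close>

text \<open>In the application \<open>D\<close> is \<open>d - m\<close> and \<open>k\<close> is the
  final exponent. Both \<open>?Q\<close> and \<open>1 + M\<close> are at least 1, so the exponents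
  \<open>c\<close> and \<open>D\<close> can be raised to \<open>k\<close>; together the two bases
  give the square of \<open>1 + M\<close>.\<close>

lemma path_bound_le_power:
  fixes N M s :: real
  assumes "0 < s" "0 \<le> M" "0 \<le> N" "s \<le> N * M" "c \<le> k" "D \<le> k" "c \<le> m"
  shows "N ^ c * s ^ (m - c) * M ^ (D + c) \<le> (N * (1 + M)\<^sup>2 / s) ^ k * s ^ m"
proof -
  let ?Q = "N * (1 + M) / s"
  \<comment> \<open>This is where \<open>s \<le> N * M\<close> enters.\<close>
  have Q: "1 \<le> ?Q" using assms by (simp add: le_divide_eq algebra_simps)
  have "N ^ c * s ^ (m - c) * M ^ (D + c) = (N * M / s) ^ c * M ^ D * s ^ m"
    using assms by (simp add: power_diff power_add power_mult_distrib power_divide)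
  also have "\<dots> \<le> ?Q ^ k * (1 + M) ^ k * s ^ m"
  proof (intro mult_right_mono mult_mono)
    have "(N * M / s) ^ c \<le> ?Q ^ c"
      using assms by (intro power_mono divide_right_mono mult_left_mono) auto
    also have "\<dots> \<le> ?Q ^ k" using Q assms by (intro power_increasing) auto
    finally show "(N * M / s) ^ c \<le> ?Q ^ k" .
    have "M ^ D \<le> (1 + M) ^ D" using assms by (intro power_mono) auto
    also have "\<dots> \<le> (1 + M) ^ k" using assms by (intro power_increasing) auto
    finally show "M ^ D \<le> (1 + M) ^ k" .
  qed (use assms Q in auto)
  also have "\<dots> = (N * (1 + M)\<^sup>2 / s) ^ k * s ^ m"
    by (simp add: power_mult_distrib[symmetric] power2_eq_square mult.assoc)
  finally show ?thesis .
qed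

theorem corollary5p15:
  fixes \<Phi> :: "real ^ 'n ^ 'n"
    and G :: "'v multigraph"
    and m d :: nat
  assumes "\<Phi> \<noteq> 0"
    and "transpose \<Phi> = \<Phi>"
    and "\<And>i j. 0 \<le> \<Phi> $ i $ j"
    and "is_multigraph G"
    and "card (verts G) = m"
    and "size (edges G) = d"
    and "\<And>v. v \<in> verts G \<Longrightarrow> 2 \<le> degree G v"
  shows "f_tilde G \<Phi> \<le>
    (real CARD('n) * (1 + linf_norm \<Phi>)\<^sup>2 / spectral_norm \<Phi>)
      powi (2 * int d - 2 * int m + int (card (conn G)))
    * spectral_norm \<Phi> ^ m"
proof -
  let ?M = "linf_norm \<Phi>" and ?s = "spectral_norm \<Phi>" and ?N = "real CARD('n)"
  have G: "\<lparr>verts = verts G, edges = edges G\<rparr> = G" by simp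
  define x where "x = (\<Sum>v\<in>verts G. degree G v - 2)"
  obtain P where P: "path_cover (verts G) (edges G) P" and cP: "card P \<le> card (conn G) + x"
    using exists_path_cover[of "verts G" "edges G"] assms(4) unfolding is_multigraph_def x_def G
    by blast
  \<comment> \<open>Since all degrees are at least 2, nothing is truncated in \<open>x\<close>, and
    the handshake lemma evaluates it as \<open>2 * d - 2 * m\<close>.\<close>
  have "(\<Sum>v\<in>verts G. degree G v) = (\<Sum>v\<in>verts G. (degree G v - 2) + 2)"
    by (intro sum.cong refl le_add_diff_inverse2[symmetric] assms(7))
  also have "\<dots> = x + 2 * m" by (subst sum.distrib) (simp add: x_def assms(5))
  finally have x: "x + 2 * m = 2 * d" using handshake[OF assms(4)] assms(6) by simp
  obtain t where t: "t + m = d + card P" "card P \<le> m"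
    and f: "f_tilde G \<Phi> \<le> ?N ^ card P * ?s ^ (m - card P) * ?M ^ t"
    using f_tilde_le_path_cover[OF assms(2,3) P] assms(5,6) by metis
  \<comment> \<open>This is the exponent of the theorem as a natural number, so the integer power
    becomes an ordinary one.\<close>
  define k where "k = card (conn G) + x"
  \<comment> \<open>The value of \<open>x\<close> forces \<open>m \<le> d\<close>, so
    \<open>d - m\<close> is exact.\<close>
  have t': "t = (d - m) + card P" using t x by linarith
  have "?N ^ card P * ?s ^ (m - card P) * ?M ^ ((d - m) + card P)
    \<le> (?N * (1 + ?M)\<^sup>2 / ?s) ^ k * ?s ^ m"
  proof (rule path_bound_le_power)
    show "0 < ?s" by (rule spectral_norm_pos) (rule assms(1))
    show "0 \<le> ?M" using abs_entry_le_linf_norm[of \<Phi> undefined undefined] by linarith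
    show "?s \<le> ?N * ?M" by (rule spectral_norm_le_linf_norm)
    \<comment> \<open>The second bound holds because \<open>x\<close> is twice
      \<open>d - m\<close>.\<close>
    show "card P \<le> k" "d - m \<le> k" "card P \<le> m" using cP x t(2) by (auto simp: k_def)
  qed simp
  moreover have "2 * int d - 2 * int m + int (card (conn G)) = int k"
    using x by (simp add: k_def)
  ultimately show ?thesis using f t' by (simp add: power_int_of_nat del: of_nat_add)
qed

end
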